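(* Let $\lambda_{0},\lambda_{1}$ be real numbers with $\min\{\lambda_{0},\lambda_{1}\}>\frac{5+\sqrt{17}}{2}$. Then \[ \mathscr{W}_{\lambda_{0}}+\mathscr{W}_{\lambda_{1}}\supseteq\mathscr{W}_{2}, \] i.e. the sumset $\{x+y:x\in\mathscr{W}_{\lambda_{0}},y\in\mathscr{W}_{\lambda_{1}}\}$ contains every irrational real number that is not very well approximable. In particular, the complement of this sumset in $\mathbb{R}$ has Lebesgue measure $0$. More precisely, writing $\lambda=\min\{\lambda_{0},\lambda_{1}\}$, \[ \dim\big((\mathscr{W}_{\lambda_{0}}+\mathscr{W}_{\lambda_{1}})^{c}\big)\leq\frac{2(2\lambda-1)}{\lambda^{2}-\lambda}<1, \] and in particular \[ \lim_{\min\{\lambda_{0},\lambda_{1}\}\to\infty}\dim\big((\mathscr{W}_{\lambda_{0}}+\mathscr{W}_{\lambda_{1}})^{c}\big)=0. \]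
   Context: $\dim$ denotes Hausdorff dimension and $A^{c}=\mathbb{R}\setminus A$. For $\xi\in\mathbb{R}$, the irrationality exponent $\mu(\xi)$ is the supremum of all $\mu$ such that $|\xi-p/q|\leq q^{-\mu}$ has infinitely many rational solutions $p/q$ ($q\geq 1$); $\mu(\xi)\geq 2$ for irrational $\xi$ and $\mu(\xi)=1$ for rational $\xi$. For $\lambda\in[2,\infty]$, $\mathscr{W}_{\lambda}=\{\xi\in\mathbb{R}:\mu(\xi)=\lambda\}$; a number $\xi$ is very well approximable if $\mu(\xi)>2$. *)

theory Defs
  imports "HOL-Analysis.Analysis" "HOL-Library.Set_Algebras"
begin

text \<open>
  The solutions \<open>p/q\<close> are counted as real numbers, not as pairs \<open>(p, q)\<close>: counting pairs would
  give every rational number the exponent \<open>\<infinity>\<close> instead of 1.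
\<close>
definition irrationality_exponent :: "real \<Rightarrow> ereal" where
  "irrationality_exponent \<xi> =
     Sup {ereal \<mu> | \<mu>. infinite {r :: real. \<exists>(p :: int) (q :: nat). q \<ge> 1 \<and>
                          r = of_int p / of_nat q \<and> \<bar>\<xi> - r\<bar> \<le> of_nat q powr (- \<mu>)}}"

definition exact_exponent_set :: "ereal \<Rightarrow> real set" ("\<W>") where
  "\<W> l = {\<xi>. irrationality_exponent \<xi> = l}"

definition very_well_approximable :: "real \<Rightarrow> bool" where
  "very_well_approximable \<xi> \<longleftrightarrow> irrationality_exponent \<xi> > 2"

text \<open>
  \<open>(diam U)\<^sup>s\<close> with the conventions of Hausdorff measure: the empty set contributes 0, and for
  \<open>s = 0\<close> every nonempty set contributes 1 (whereas \<open>0 powr 0 = 0\<close> in HOL).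
\<close>
definition diameter_power :: "real \<Rightarrow> 'a::metric_space set \<Rightarrow> ennreal" where
  "diameter_power s U =
     (if U = {} then 0 else if s = 0 then 1 else ennreal (diameter U powr s))"

text \<open>Boundedness is required because \<open>diameter\<close> is only meaningful for bounded sets.\<close>
definition hausdorff_premeasure :: "real \<Rightarrow> real \<Rightarrow> 'a::metric_space set \<Rightarrow> ennreal" where
  "hausdorff_premeasure s \<delta> A =
     (INF U \<in> {U :: nat \<Rightarrow> 'a set. A \<subseteq> (\<Union>i. U i) \<and> (\<forall>i. bounded (U i) \<and> diameter (U i) \<le> \<delta>)}.
        \<Sum>i. diameter_power s (U i))"

text \<open>The limit as \<open>\<delta> \<rightarrow> 0\<close> is a supremum, since the premeasure is antitone in \<open>\<delta>\<close>.\<close>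
definition hausdorff_measure :: "real \<Rightarrow> 'a::metric_space set \<Rightarrow> ennreal" where
  "hausdorff_measure s A = (SUP \<delta> \<in> {0<..}. hausdorff_premeasure s \<delta> A)"

definition hausdorff_dim :: "'a::metric_space set \<Rightarrow> ereal" where
  "hausdorff_dim A = Inf {ereal s | s. s \<ge> 0 \<and> hausdorff_measure s A = 0}"

end

theory Submission
  imports Defs "HOL-Real_Asymp.Real_Asymp"
begin

text \<open>
  Put \<open>\<tau> = (\<lambda>\<^sup>2 - \<lambda>) / (2 \<lambda> - 1)\<close>, so that \<open>1/\<tau> = 1/\<lambda> + 1/(\<lambda> - 1)\<close>. If \<open>\<bar>\<xi> - p/q\<bar> > q\<close> to the power \<open>- t\<close>
  for all large \<open>q\<close> and some \<open>t < \<tau>\<close>, then \<open>\<xi>\<close> lies in the sumset: choose nested intervals such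
  that \<open>x\<close> and \<open>y = \<xi> - x\<close> are alternately approximated by reduced fractions with denominators
  \<open>b\<^sub>0 < b\<^sub>1 < \<dots>\<close> (powers of 2), each about the previous one to the power \<open>\<lambda>\<^sub>0\<close> or \<open>\<lambda>\<^sub>1\<close>, and to
  exactly the required order. No other fraction is a better approximation of \<open>x\<close>: for \<open>q\<close> not too
  far from the denominator \<open>b\<close> of a chosen approximation \<open>a/b\<close> of \<open>x\<close>, because distinct fractions
  are at least \<open>1/(b q)\<close> apart; for the other \<open>q\<close>, because adding a fraction with denominator \<open>q\<close>
  close to \<open>x\<close> to the next chosen approximation of \<open>y\<close> would approximate \<open>\<xi>\<close> too well. The
  condition \<open>t < \<tau>\<close> makes these two ranges of \<open>q\<close> overlap. Hence the complement of the sumset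
  consists of numbers approximable to every order \<open>t < \<tau>\<close>, and the easy half of the
  Jarnik-Besicovitch theorem bounds its dimension by \<open>2/\<tau>\<close>.
\<close>

lemma finite_fractions_near:
  fixes x :: real
  shows "finite {r. \<exists>(p :: int) (q :: nat). q \<ge> 1 \<and> q \<le> N \<and> r = of_int p / of_nat q \<and> \<bar>x - r\<bar> \<le> 1}"
    (is "finite ?S")
proof -
  define K where "K = \<lceil>(\<bar>x\<bar> + 1) * real N\<rceil>"
  have "?S \<subseteq> (\<lambda>(p, q). of_int p / of_nat q) ` ({-K..K} \<times> {1..N})"
  proof
    fix r assume "r \<in> ?S"
    then obtain p :: int and q :: nat where q: "1 \<le> q" "q \<le> N" and r: "r = of_int p / of_nat q"
      and d: "\<bar>x - r\<bar> \<le> 1" by auto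
    have "\<bar>of_int p\<bar> = \<bar>r\<bar> * real q"
      using q r by (simp add: abs_mult)
    also have "\<dots> \<le> (\<bar>x\<bar> + 1) * real N"
      using d q by (intro mult_mono) auto
    finally have "\<bar>p\<bar> \<le> K"
      unfolding K_def by linarith
    then show "r \<in> (\<lambda>(p, q). of_int p / of_nat q) ` ({-K..K} \<times> {1..N})"
      using q r by force
  qed
  then show ?thesis
    by (rule finite_subset) auto
qed

lemma fraction_distance_ge:
  fixes p a :: int and q b :: nat
  assumes "q \<ge> 1" "b \<ge> 1" and ne: "real_of_int p / real q \<noteq> real_of_int a / real b"
  shows "1 / (real b * real q) \<le> \<bar>real_of_int a / real b - real_of_int p / real q\<bar>"
proof -
  have "a * int q - p * int b \<noteq> 0"
  proof
    assume "a * int q - p * int b = 0"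
    then have "real_of_int a * real q = real_of_int p * real b"
      by (metis eq_iff_diff_eq_0 of_int_mult of_int_of_nat_eq)
    then show False using assms by (simp add: field_simps)
  qed
  then have "1 \<le> \<bar>a * int q - p * int b\<bar>" by linarith
  then have "real_of_int 1 \<le> real_of_int \<bar>a * int q - p * int b\<bar>"
    by (simp only: of_int_le_iff)
  then have "1 \<le> \<bar>real_of_int a * real q - real_of_int p * real b\<bar>"
    by simp
  moreover have "real_of_int a / real b - real_of_int p / real q =
      (real_of_int a * real q - real_of_int p * real b) / (real b * real q)"
    using assms by (simp add: field_simps)
  ultimately show ?thesis
    using assms by (simp add: abs_mult divide_right_mono)
qed

lemma irrationality_exponent_Rats_le:
  assumes "\<xi> \<in> \<rat>"
  shows "irrationality_exponent \<xi> \<le> 1"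
proof -
  obtain a :: int and b :: nat where b: "b \<ge> 1" and \<xi>: "\<xi> = of_int a / of_nat b"
    using assms unfolding Rats_eq_int_div_nat by (auto simp: Suc_le_eq)
  show ?thesis
    unfolding irrationality_exponent_def
  proof (rule Sup_least, clarify)
    fix \<mu> :: real
    let ?S = "{r :: real. \<exists>(p :: int) (q :: nat). q \<ge> 1 \<and>
                          r = of_int p / of_nat q \<and> \<bar>\<xi> - r\<bar> \<le> of_nat q powr (- \<mu>)}"
    assume inf: "infinite ?S"
    show "ereal \<mu> \<le> 1"
    proof (rule ccontr)
      assume "\<not> ereal \<mu> \<le> 1"
      then have \<mu>: "\<mu> > 1" by simp
      define N where "N = nat \<lceil>real b powr (1 / (\<mu> - 1))\<rceil>"
      have "?S \<subseteq> insert \<xi> {r. \<exists>(p :: int) (q :: nat). q \<ge> 1 \<and> q \<le> N \<and> r = of_int p / of_nat q \<and> \<bar>\<xi> - r\<bar> \<le> 1}"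
      proof
        fix r assume "r \<in> ?S"
        then obtain p :: int and q :: nat where q: "1 \<le> q" and r: "r = of_int p / of_nat q"
          and d: "\<bar>\<xi> - r\<bar> \<le> of_nat q powr (- \<mu>)" by auto
        have "q \<le> N" if "r \<noteq> \<xi>"
        proof -
          have "1 / (real b * real q) \<le> real q powr (- \<mu>)"
            using fraction_distance_ge[OF q b, of p a] that d by (auto simp: r \<xi>)
          then have "real q powr \<mu> \<le> real b * real q"
            using q b by (simp add: powr_minus field_simps)
          then have "real q powr (\<mu> - 1) \<le> real b"
            using q by (simp add: powr_diff field_simps)
          then have "(real q powr (\<mu> - 1)) powr (1 / (\<mu> - 1)) \<le> real b powr (1 / (\<mu> - 1))"
            using \<mu> by (intro powr_mono2) auto
          then have "real q \<le> real b powr (1 / (\<mu> - 1))"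
            using \<mu> q by (simp add: powr_powr)
          then show ?thesis unfolding N_def by linarith
        qed
        moreover have "real q powr (- \<mu>) \<le> 1"
          using q \<mu> powr_mono[of "- \<mu>" 0 "real q"] by simp
        ultimately show "r \<in> insert \<xi> {r. \<exists>(p :: int) (q :: nat). q \<ge> 1 \<and> q \<le> N \<and> r = of_int p / of_nat q \<and> \<bar>\<xi> - r\<bar> \<le> 1}"
          using q r d order_trans[OF d] by blast
      qed
      then have "finite ?S"
        by (rule finite_subset) (intro finite.insertI finite_fractions_near)
      then show False using inf by simp
    qed
  qed
qed

text \<open>Here every pair \<open>(p, q)\<close> counts, so that all rational numbers belong to the set.\<close>
definition approximable :: "real \<Rightarrow> real set" where
  "approximable t = {\<xi>. \<forall>Q. \<exists>(p :: int) (q :: nat). q \<ge> Q \<and> q \<ge> 1 \<and>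
      \<bar>\<xi> - of_int p / of_nat q\<bar> \<le> of_nat q powr (- t)}"

lemma not_approximable_if_exponent_less:
  assumes "\<xi> \<notin> \<rat>" and less: "irrationality_exponent \<xi> < ereal t" and t: "t > 0"
  shows "\<xi> \<notin> approximable t"
proof
  assume appr: "\<xi> \<in> approximable t"
  let ?S = "{r :: real. \<exists>(p :: int) (q :: nat). q \<ge> 1 \<and>
                          r = of_int p / of_nat q \<and> \<bar>\<xi> - r\<bar> \<le> of_nat q powr (- t)}"
  have "\<not> ereal t \<le> irrationality_exponent \<xi>"
    using less by simp
  then have "ereal t \<notin> {ereal \<mu> |\<mu>. infinite {r :: real. \<exists>(p :: int) (q :: nat). q \<ge> 1 \<and>
                          r = of_int p / of_nat q \<and> \<bar>\<xi> - r\<bar> \<le> of_nat q powr (- \<mu>)}}"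
    unfolding irrationality_exponent_def by (rule contrapos_nn) (rule Sup_upper)
  then have fin: "finite ?S"
    by simp
  have "\<forall>\<^sub>F q in sequentially. \<forall>r\<in>?S. real q powr (- t) < \<bar>\<xi> - r\<bar>"
  proof (intro eventually_ball_finite[OF fin] ballI)
    fix r assume "r \<in> ?S"
    then have "r \<in> \<rat>" by auto
    then have "\<bar>\<xi> - r\<bar> > 0" using assms(1) by auto
    moreover have "(\<lambda>q. real q powr (- t)) \<longlonglongrightarrow> 0"
      using t by (intro tendsto_neg_powr filterlim_real_sequentially) auto
    ultimately show "\<forall>\<^sub>F q in sequentially. real q powr (- t) < \<bar>\<xi> - r\<bar>"
      by (simp add: order_tendstoD)
  qed
  then obtain Q where Q: "\<And>q r. q \<ge> Q \<Longrightarrow> r \<in> ?S \<Longrightarrow> real q powr (- t) < \<bar>\<xi> - r\<bar>"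
    unfolding eventually_sequentially by blast
  obtain p :: int and q :: nat where "q \<ge> Q" "q \<ge> 1" "\<bar>\<xi> - of_int p / of_nat q\<bar> \<le> of_nat q powr (- t)"
    using appr unfolding approximable_def by blast
  then have "of_int p / of_nat q \<in> ?S" by blast
  with Q[of q "of_int p / of_nat q"] \<open>q \<ge> Q\<close> \<open>\<bar>_\<bar> \<le> _\<close> show False by fastforce
qed

lemma bounded_odd_fraction:
  fixes X :: real
  shows "\<exists>a :: int. odd a \<and> X \<le> of_int a / 2 ^ m \<and> of_int a / 2 ^ m \<le> X + 2 / 2 ^ m"
proof -
  define Y k where "Y = X * 2 ^ m" and "k = \<lceil>(Y - 1) / 2\<rceil>"
  have "(Y - 1) / 2 \<le> of_int k" "of_int k \<le> (Y - 1) / 2 + 1"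
    unfolding k_def by (rule le_of_int_ceiling, rule of_int_ceiling_le_add_one)
  then have "Y \<le> 2 * of_int k + 1" "2 * of_int k + 1 \<le> Y + 2"
    by (simp_all add: field_simps)
  moreover have "X = Y / 2 ^ m" "X + 2 / 2 ^ m = (Y + 2) / 2 ^ m"
    by (simp_all add: Y_def add_divide_distrib)
  ultimately have "X \<le> of_int (2 * k + 1) / 2 ^ m" "of_int (2 * k + 1) / 2 ^ m \<le> X + 2 / 2 ^ m"
    by (simp_all add: divide_right_mono)
  then show ?thesis by (intro exI[of _ "2 * k + 1"]) simp
qed

lemma odd_dyadic_denominator_le:
  fixes a p :: int and q m :: nat
  assumes "odd a" "q \<ge> 1" and eq: "of_int p / real q = of_int a / 2 ^ m"
  shows "2 ^ m \<le> q"
proof -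
  have "real_of_int (p * 2 ^ m) = real_of_int (a * int q)"
    using eq \<open>q \<ge> 1\<close> by (simp add: field_simps)
  then have "p * 2 ^ m = a * int q"
    by (simp only: of_int_eq_iff)
  then have "2 ^ m dvd a * int q"
    by (metis dvd_triv_right)
  moreover have "coprime (2 ^ m) a"
    using \<open>odd a\<close> by simp
  ultimately have "(2 :: int) ^ m dvd int q"
    by (simp add: coprime_dvd_mult_right_iff)
  then have "2 ^ m dvd q"
    by (metis int_dvd_int_iff of_nat_numeral of_nat_power)
  then show ?thesis
    using \<open>q \<ge> 1\<close> by (simp add: dvd_imp_le)
qed

lemma odd_dyadic_eqD:
  fixes a b :: int
  assumes "odd a" "odd b" "of_int a / 2 ^ m = (of_int b / 2 ^ n :: real)"
  shows "m = n"
proof -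
  have "2 ^ m \<le> (2 :: nat) ^ n" "2 ^ n \<le> (2 :: nat) ^ m"
    using odd_dyadic_denominator_le[of a "2 ^ n" b m] odd_dyadic_denominator_le[of b "2 ^ m" a n] assms
    by auto
  then show ?thesis by simp
qed

lemma distance_near_fraction_ge:
  fixes p a :: int and q b :: nat
  assumes "q \<ge> 1" "b \<ge> 1" and ne: "of_int p / real q \<noteq> of_int a / real b"
    and near: "\<bar>x - of_int a / real b\<bar> \<le> real b powr (- l)"
    and upper: "2 * real q \<le> real b powr (l - 1)" and lower: "2 * real b \<le> real q powr (l - 1)"
  shows "real q powr (- l) \<le> \<bar>x - of_int p / real q\<bar>"
proof -
  have "real b powr (- l) = 1 / (real b * real b powr (l - 1))"
    using \<open>b \<ge> 1\<close> by (simp add: powr_minus powr_diff field_simps)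
  also have "\<dots> \<le> 1 / (real b * (2 * real q))"
    using upper assms(1,2) by (intro divide_left_mono mult_left_mono) auto
  finally have 1: "real b powr (- l) \<le> 1 / (real b * (2 * real q))" .
  have "real q powr (- l) = 1 / (real q powr (l - 1) * real q)"
    using \<open>q \<ge> 1\<close> by (simp add: powr_minus powr_diff field_simps)
  also have "\<dots> \<le> 1 / (2 * real b * real q)"
    using lower assms(1,2) by (intro divide_left_mono mult_right_mono) auto
  finally have 2: "real q powr (- l) \<le> 1 / (2 * real b * real q)" .
  have "1 / (real b * real q) \<le> \<bar>of_int a / real b - of_int p / real q\<bar>"
    using fraction_distance_ge[OF assms(1,2) ne] .
  moreover have "1 / (real b * real q) = 1 / (real b * (2 * real q)) + 1 / (2 * real b * real q)"
    using assms(1,2) by (simp add: field_simps)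
  ultimately show ?thesis
    using near 1 2 by linarith
qed

text \<open>Adding the approximation \<open>c/d\<close> of \<open>\<xi> - x\<close> to a fraction \<open>p/q\<close> close to \<open>x\<close> gives a fraction
  with denominator \<open>q d\<close> close to \<open>\<xi>\<close>.\<close>
lemma distance_complementary_fraction_ge:
  fixes p c :: int and q d :: nat
  assumes "q \<ge> 1" "d \<ge> 1"
    and bad: "\<And>p :: int. real (q * d) powr (- t) \<le> \<bar>\<xi> - of_int p / real (q * d)\<bar>"
    and near: "\<bar>\<xi> - x - of_int c / real d\<bar> \<le> real d powr (- l')"
    and upper: "2 * (real q * real d) powr t \<le> real d powr l'"
    and lower: "2 * real d powr t \<le> real q powr (l - t)"
  shows "real q powr (- l) \<le> \<bar>x - of_int p / real q\<bar>"
proof -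
  let ?e = "(real q * real d) powr (- t)"
  have "?e \<le> \<bar>\<xi> - of_int (p * int d + c * int q) / real (q * d)\<bar>"
    using bad[of "p * int d + c * int q"] by simp
  also have "of_int (p * int d + c * int q) / real (q * d) = of_int p / real q + of_int c / real d"
    using assms(1,2) by (simp add: field_simps)
  finally have 1: "?e \<le> \<bar>\<xi> - (of_int p / real q + of_int c / real d)\<bar>" .
  have 2: "real d powr (- l') \<le> ?e / 2"
    using upper assms(1,2) by (simp add: powr_minus field_simps)
  have "2 * real q powr t * real d powr t \<le> real q powr l"
    using lower assms(1,2) by (simp add: powr_diff field_simps)
  then have "real q powr (- l) \<le> ?e / 2"
    using assms(1,2) by (simp add: powr_minus powr_mult field_simps)
  then show ?thesis
    using 1 2 near by linarith
qed

lemma exponent_eqI: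
  fixes x l q\<^sub>0 :: real and a :: "nat \<Rightarrow> int" and m :: "nat \<Rightarrow> nat"
  assumes odd: "\<And>k. odd (a k)" and m: "strict_mono m" and l: "l > 0"
    and lower: "\<And>k. 2 powr (- l * m k) / 2 \<le> \<bar>x - a k / 2 ^ m k\<bar>"
    and upper: "\<And>k. \<bar>x - a k / 2 ^ m k\<bar> \<le> 2 powr (- l * m k)"
    and rest: "\<And>(p :: int) (q :: nat). q\<^sub>0 \<le> real q \<Longrightarrow> q \<ge> 1 \<Longrightarrow> (\<And>k. p / real q \<noteq> a k / 2 ^ m k) \<Longrightarrow>
      real q powr (- l) \<le> \<bar>x - p / real q\<bar>"
  shows "irrationality_exponent x = ereal l"
  unfolding irrationality_exponent_def
proof (rule antisym)
  let ?S = "\<lambda>\<mu>. {r :: real. \<exists>(p :: int) (q :: nat). q \<ge> 1 \<and>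
                          r = of_int p / of_nat q \<and> \<bar>x - r\<bar> \<le> of_nat q powr (- \<mu>)}"
  have "inj (\<lambda>k. a k / (2 ^ m k :: real))"
    using odd_dyadic_eqD[OF odd odd] m by (auto intro!: injI dest: strict_mono_eq)
  then have "infinite (range (\<lambda>k. a k / (2 ^ m k :: real)))"
    by (rule range_inj_infinite)
  moreover have "range (\<lambda>k. a k / (2 ^ m k :: real)) \<subseteq> ?S l"
  proof clarify
    fix k
    have "real (2 ^ m k) powr (- l) = 2 powr (- l * m k)"
      by (simp add: powr_realpow[symmetric] powr_powr mult.commute)
    then show "\<exists>(p :: int) (q :: nat). q \<ge> 1 \<and> a k / 2 ^ m k = p / real q \<and>
        \<bar>x - a k / 2 ^ m k\<bar> \<le> real q powr (- l)"
      using upper[of k] by (intro exI[of _ "a k"] exI[of _ "2 ^ m k"]) auto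
  qed
  ultimately have "infinite (?S l)"
    by (meson finite_subset)
  then show "ereal l \<le> Sup {ereal \<mu> |\<mu>. infinite (?S \<mu>)}"
    by (intro Sup_upper) blast
next
  let ?S = "\<lambda>\<mu>. {r :: real. \<exists>(p :: int) (q :: nat). q \<ge> 1 \<and>
                          r = of_int p / of_nat q \<and> \<bar>x - r\<bar> \<le> of_nat q powr (- \<mu>)}"
  show "Sup {ereal \<mu> |\<mu>. infinite (?S \<mu>)} \<le> ereal l"
  proof (rule Sup_least, clarify)
    fix \<mu> assume inf: "infinite (?S \<mu>)"
    show "ereal \<mu> \<le> ereal l"
    proof (rule ccontr)
      assume "\<not> ereal \<mu> \<le> ereal l"
      then have \<mu>: "\<mu> > l" by simp
      define N where "N = nat \<lceil>max q\<^sub>0 1\<rceil>"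
      define M where "M = nat \<lceil>1 / (\<mu> - l)\<rceil>"
      let ?near = "{r. \<exists>(p :: int) (q :: nat). q \<ge> 1 \<and> q \<le> N \<and> r = of_int p / of_nat q \<and> \<bar>x - r\<bar> \<le> 1}"
      let ?dyadic = "(\<lambda>k. a k / (2 ^ m k :: real)) ` {..M}"
      have "?S \<mu> \<subseteq> ?near \<union> ?dyadic"
      proof
        fix r assume "r \<in> ?S \<mu>"
        then obtain p :: int and q :: nat where q: "q \<ge> 1" and r: "r = p / real q"
          and close: "\<bar>x - r\<bar> \<le> real q powr (- \<mu>)" by blast
        show "r \<in> ?near \<union> ?dyadic"
        proof (cases "\<exists>k. r = a k / 2 ^ m k")
          case True
          then obtain k where k: "r = a k / 2 ^ m k" by blast
          have "real (2 ^ m k) \<le> real q"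
            using odd_dyadic_denominator_le[OF odd[of k] q, of p "m k"] k r
            by (simp only: of_nat_le_iff)
          then have "real q powr (- \<mu>) \<le> real (2 ^ m k) powr (- \<mu>)"
            using \<mu> l by (intro powr_mono2') auto
          also have "\<dots> = 2 powr (- \<mu> * m k)"
            by (simp add: powr_realpow[symmetric] powr_powr mult.commute)
          finally have "2 powr (- l * m k) / 2 \<le> 2 powr (- \<mu> * m k)"
            using lower[of k] close k by linarith
          then have "2 powr (- l * m k - 1) \<le> 2 powr (- \<mu> * m k)"
            by (simp add: powr_diff)
          then have "(\<mu> - l) * m k \<le> 1"
            by (simp add: algebra_simps)
          then have "m k \<le> 1 / (\<mu> - l)"
            using \<mu> by (simp add: field_simps)
          then have "m k \<le> M" unfolding M_def by linarith
          then have "k \<le> M"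
            using strict_mono_imp_increasing[OF m, of k] by linarith
          then show ?thesis using k by blast
        next
          case False
          have "q \<le> N"
          proof (rule ccontr)
            assume "\<not> q \<le> N"
            then have "q\<^sub>0 \<le> real q" "real q > 1" unfolding N_def by linarith+
            then have "real q powr (- l) \<le> \<bar>x - r\<bar>"
              using rest[of q p] q r False by auto
            moreover have "real q powr (- \<mu>) < real q powr (- l)"
              using \<open>real q > 1\<close> \<mu> by (intro powr_less_mono) auto
            ultimately show False using close by linarith
          qed
          moreover have "real q powr (- \<mu>) \<le> 1"
            using q \<mu> l powr_mono[of "- \<mu>" 0 "real q"] by simp
          ultimately show ?thesis
            using q r order_trans[OF close] by blast
        qed
      qed
      then have "finite (?S \<mu>)"
        by (rule finite_subset) (intro finite_UnI finite_fractions_near finite_imageI finite_atMost)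
      then show False using inf by simp
    qed
  qed
qed

text \<open>Every large \<open>q\<close> is treated by comparison with \<open>a\<^sub>k/2^(m k)\<close> or, beyond the range of that
  argument, by means of \<open>c\<^sub>k/2^(d k)\<close>; the inequalities \<open>range1\<close> and \<open>range2\<close> make these ranges
  of \<open>q\<close> overlap.\<close>
lemma exponent_eqI_two_sided:
  fixes x \<xi> l l' t :: real and a c :: "nat \<Rightarrow> int" and m d :: "nat \<Rightarrow> nat"
  assumes odd: "\<And>k. odd (a k)" and m: "strict_mono m"
    and l: "l > 1" "l > t" and t: "t > 0"
    and lower: "\<And>k. 2 powr (- l * m k) / 2 \<le> \<bar>x - a k / 2 ^ m k\<bar>"
    and upper: "\<And>k. \<bar>x - a k / 2 ^ m k\<bar> \<le> 2 powr (- l * m k)"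
    and compl: "\<And>k. \<bar>\<xi> - x - c k / 2 ^ d k\<bar> \<le> 2 powr (- l' * d k)"
    and d_le: "\<And>k. d k \<le> l * m k + 4" and m_le: "\<And>k. m (Suc k) \<le> l' * d k + 4"
    and bad: "\<And>k (p :: int) (q :: nat). q \<ge> 1 \<Longrightarrow>
      real (q * 2 ^ d k) powr (- t) \<le> \<bar>\<xi> - p / real (q * 2 ^ d k)\<bar>"
    and range1: "\<And>k. 1 + t * (l * m k + 4) \<le> (l - t) * ((l - 1) * m k - 1)"
    and range2: "\<And>k. 1 + t * ((l' * d k + 5) / (l - 1) + d k) \<le> l' * d k"
  shows "irrationality_exponent x = ereal l"
proof (rule exponent_eqI[OF odd m _ lower upper])
  show "l > 0" using l by simp
next
  fix p :: int and q :: nat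
  assume q0: "2 powr ((1 + m 0) / (l - 1)) \<le> real q" and q: "q \<ge> 1"
    and ne: "\<And>k. p / real q \<noteq> a k / 2 ^ m k"
  define L where "L = log 2 q"
  have qL: "real q = 2 powr L"
    using q by (simp add: L_def)
  define P where "P = (\<lambda>k. 1 + m k \<le> (l - 1) * L)"
  have "(1 + m 0) / (l - 1) \<le> L"
    using q0 by (simp add: qL)
  then have "P 0"
    using l by (simp add: P_def field_simps)
  moreover have "\<exists>k. \<not> P k"
  proof -
    obtain k :: nat where "(l - 1) * L < k"
      using reals_Archimedean2 by blast
    then have "\<not> P k"
      using strict_mono_imp_increasing[OF m, of k] unfolding P_def by linarith
    then show ?thesis ..
  qed
  ultimately obtain k where k: "P k" "\<not> P (Suc k)"
    by (metis nat_induct)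
  have pow: "real (2 ^ n) powr s = 2 powr (s * real n)" for n s
    by (simp add: powr_realpow[symmetric] powr_powr mult.commute)
  have pow1: "2 ^ n = 2 powr real n" for n
    by (simp add: powr_realpow)
  show "real q powr (- l) \<le> \<bar>x - p / real q\<bar>"
  proof (cases "1 + L \<le> (l - 1) * m k")
    case True
    show ?thesis
    proof (rule distance_near_fraction_ge[of q "2 ^ m k" p "a k"])
      show "\<bar>x - a k / real (2 ^ m k)\<bar> \<le> real (2 ^ m k) powr (- l)"
        using upper[of k] by (simp only: pow) simp
      have "2 * real q = 2 powr (1 + L)" by (simp add: qL powr_add)
      then show "2 * real q \<le> real (2 ^ m k) powr (l - 1)"
        using True by (simp only: pow) simp
      have "2 * real (2 ^ m k) = 2 powr (1 + m k)" by (simp add: pow1 powr_add)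
      also have "\<dots> \<le> 2 powr ((l - 1) * L)"
        using k(1) by (simp add: P_def)
      also have "\<dots> = real q powr (l - 1)"
        by (simp add: qL powr_powr mult.commute)
      finally show "2 * real (2 ^ m k) \<le> real q powr (l - 1)" .
    qed (use q ne in auto)
  next
    case False
    show ?thesis
    proof (rule distance_complementary_fraction_ge[of q "2 ^ d k" t \<xi> x "c k" l'])
      show "\<bar>\<xi> - x - c k / real (2 ^ d k)\<bar> \<le> real (2 ^ d k) powr (- l')"
        using compl[of k] by (simp only: pow) simp
      show "real (q * 2 ^ d k) powr (- t) \<le> \<bar>\<xi> - p / real (q * 2 ^ d k)\<bar>" for p :: int
        using bad[OF q] by blast
      have "(l - 1) * L \<le> l' * d k + 5"
        using k(2) m_le[of k] by (simp add: P_def)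
      then have "L \<le> (l' * d k + 5) / (l - 1)"
        using l by (simp add: field_simps)
      then have "t * (L + d k) \<le> t * ((l' * d k + 5) / (l - 1) + d k)"
        using t by (intro mult_left_mono) auto
      then have "1 + t * (L + d k) \<le> l' * d k"
        using range2[of k] by linarith
      then have "2 powr (1 + (L + d k) * t) \<le> 2 powr (l' * d k)"
        by (simp add: mult.commute)
      moreover have "real q * real (2 ^ d k) = 2 powr (L + d k)"
        by (simp add: qL pow1 powr_add)
      then have "2 powr (1 + (L + d k) * t) = 2 * (real q * real (2 ^ d k)) powr t"
        by (simp only: powr_powr powr_add[of 2 1]) simp
      ultimately show "2 * (real q * real (2 ^ d k)) powr t \<le> real (2 ^ d k) powr l'"
        by (simp only: pow)
      have "t * d k \<le> t * (l * m k + 4)"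
        using t d_le[of k] by (intro mult_left_mono) auto
      moreover have "(l - t) * ((l - 1) * m k - 1) \<le> (l - t) * L"
        using False l by (intro mult_left_mono) auto
      ultimately have "1 + t * d k \<le> (l - t) * L"
        using range1[of k] by linarith
      then have "2 powr (1 + t * d k) \<le> 2 powr ((l - t) * L)" by simp
      moreover have "2 powr (1 + t * d k) = 2 * real (2 ^ d k) powr t"
        by (simp only: pow powr_add) simp
      ultimately show "2 * real (2 ^ d k) powr t \<le> real q powr (l - t)"
        by (simp add: qL powr_powr mult.commute)
    qed (use q in auto)
  qed
qed

lemma approximable_subset_cover:
  fixes \<epsilon> t :: real and Q :: nat
  assumes "\<epsilon> > 0" and t: "t > 0" and Q: "Q \<ge> 1"
  defines "K \<equiv> \<lambda>q::nat. nat \<lfloor>real q powr (1 + \<epsilon>)\<rfloor>"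
  shows "approximable t \<subseteq> (\<Union>n. \<Union>j\<in>{..2 * K (n + Q)}.
    cball ((real j - real (K (n + Q))) / real (n + Q)) (real (n + Q) powr (- t)))"
proof
  fix \<xi> assume \<xi>: "\<xi> \<in> approximable t"
  have "filterlim (\<lambda>q. real q powr \<epsilon>) at_top sequentially"
    using \<open>\<epsilon> > 0\<close> by real_asymp
  then have "\<forall>\<^sub>F q in sequentially. \<bar>\<xi>\<bar> + 1 \<le> real q powr \<epsilon>"
    by (simp add: filterlim_at_top)
  then obtain Q' where Q': "\<And>q. q \<ge> Q' \<Longrightarrow> \<bar>\<xi>\<bar> + 1 \<le> real q powr \<epsilon>"
    unfolding eventually_sequentially by blast
  obtain p :: int and q :: nat where q: "q \<ge> max Q Q'" "q \<ge> 1"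
    and close: "\<bar>\<xi> - of_int p / real q\<bar> \<le> real q powr (- t)"
    using \<xi> unfolding approximable_def by blast
  have "real q powr (- t) \<le> 1"
    using q t powr_mono[of "- t" 0 "real q"] by simp
  then have "\<bar>of_int p / real q\<bar> \<le> \<bar>\<xi>\<bar> + 1"
    using close by linarith
  also have "\<dots> \<le> real q powr \<epsilon>"
    using Q' q by simp
  finally have "\<bar>real_of_int p\<bar> \<le> real q powr (1 + \<epsilon>)"
    using q by (simp add: powr_add field_simps)
  then have p: "\<bar>p\<bar> \<le> int (K q)"
    unfolding K_def by linarith
  define n j where "n = q - Q" and "j = nat (p + int (K q))"
  have nQ: "n + Q = q" using q by (simp add: n_def)
  have "real j - real (K q) = of_int p"
    using p by (simp add: j_def)
  then have "\<xi> \<in> cball ((real j - real (K q)) / real q) (real q powr (- t))"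
    using close by (simp add: dist_real_def abs_minus_commute)
  moreover have "j \<le> 2 * K q"
    using p by (simp add: j_def)
  ultimately show "\<xi> \<in> (\<Union>n. \<Union>j\<in>{..2 * K (n + Q)}.
    cball ((real j - real (K (n + Q))) / real (n + Q)) (real (n + Q) powr (- t)))"
    using nQ by blast
qed

lemma hausdorff_premeasure_approximable:
  assumes t: "t > 0" and s: "s * t > 2" "s > 0" and \<delta>: "\<delta> > 0"
  shows "hausdorff_premeasure s \<delta> (approximable t) = 0"
proof -
  define \<epsilon> where "\<epsilon> = (s * t - 2) / 2"
  have \<epsilon>: "\<epsilon> > 0" "1 + \<epsilon> - s * t < - 1"
    using s by (simp_all add: \<epsilon>_def field_simps)
  define K where "K = (\<lambda>q::nat. nat \<lfloor>real q powr (1 + \<epsilon>)\<rfloor>)"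
  define g where "g = (\<lambda>q::nat. 3 * 2 powr s * real q powr (1 + \<epsilon> - s * t))"
  have g0: "g q \<ge> 0" for q by (simp add: g_def)
  have g: "summable g"
    unfolding g_def using \<epsilon> by (intro summable_mult) (simp add: summable_real_powr_iff)
  have "hausdorff_premeasure s \<delta> (approximable t) \<le> ennreal e" if e: "e > 0" for e
  proof -
    have "(\<lambda>q. 2 * real q powr (- t)) \<longlonglongrightarrow> 0"
      using t by real_asymp
    then have "\<forall>\<^sub>F q in sequentially. 2 * real q powr (- t) < \<delta>"
      using \<delta> by (rule order_tendstoD)
    then obtain Q1 where Q1: "\<And>q. q \<ge> Q1 \<Longrightarrow> 2 * real q powr (- t) < \<delta>"
      unfolding eventually_sequentially by blast
    obtain Q2 where Q2: "\<And>q. q \<ge> Q2 \<Longrightarrow> norm (\<Sum>i. g (i + q)) < e"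
      using suminf_exist_split[OF e g] by blast
    define Q where "Q = Suc (max Q1 Q2)"
    define B where "B = (\<lambda>(n, j). if j \<le> 2 * K (n + Q)
      then cball ((real j - real (K (n + Q))) / real (n + Q)) (real (n + Q) powr (- t)) else {})"
    have diam: "diameter (B (n, j)) \<le> 2 * real (n + Q) powr (- t)" for n j
      by (simp add: B_def)
    have bnd: "bounded (B (n, j))" for n j
      by (simp add: B_def)
    have "approximable t \<subseteq> (\<Union>n. \<Union>j\<in>{..2 * K (n + Q)}.
      cball ((real j - real (K (n + Q))) / real (n + Q)) (real (n + Q) powr (- t)))"
      unfolding K_def using \<epsilon> t by (intro approximable_subset_cover) (auto simp: Q_def)
    also have "\<dots> \<subseteq> (\<Union>z. B z)"
      unfolding B_def by fastforce
    also have "\<dots> = (\<Union>i. B (prod_decode i))"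
      using surj_prod_decode by (metis image_image)
    finally have sub: "approximable t \<subseteq> (\<Union>i. B (prod_decode i))" .
    have "Q1 \<le> n + Q" for n by (simp add: Q_def)
    then have "diameter (B (n, j)) \<le> \<delta>" for n j
      using diam[of n j] Q1[of "n + Q"] by fastforce
    then have "bounded (B z) \<and> diameter (B z) \<le> \<delta>" for z
      using bnd by (cases z) auto
    then have "hausdorff_premeasure s \<delta> (approximable t) \<le> (\<Sum>i. diameter_power s (B (prod_decode i)))"
      unfolding hausdorff_premeasure_def using sub by (intro INF_lower) auto
    also have "\<dots> = (\<Sum>n. \<Sum>j. diameter_power s (B (n, j)))"
      by (rule suminf_ennreal_2dimen) simp
    also have "\<dots> \<le> (\<Sum>n. ennreal (g (n + Q)))"
    proof (intro suminf_le summableI)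
      fix n
      define q where "q = n + Q"
      have q: "q \<ge> 1" by (simp add: q_def Q_def)
      have "(\<Sum>j. diameter_power s (B (n, j))) = (\<Sum>j\<in>{..2 * K q}. diameter_power s (B (n, j)))"
        by (intro suminf_finite) (auto simp: B_def diameter_power_def q_def)
      also have "\<dots> \<le> (\<Sum>j\<in>{..2 * K q}. ennreal ((2 * real q powr (- t)) powr s))"
        using s diam by (intro sum_mono)
          (auto simp: diameter_power_def q_def diameter_ge_0 bnd intro!: ennreal_leI powr_mono2)
      also have "\<dots> = ennreal (real (2 * K q + 1) * (2 * real q powr (- t)) powr s)"
        by (simp add: ennreal_mult ennreal_of_nat_eq_real_of_nat)
      also have "\<dots> \<le> ennreal (g q)"
      proof (rule ennreal_leI)
        have "1 \<le> real q powr (1 + \<epsilon>)"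
          using q \<epsilon> by (intro ge_one_powr_ge_zero) auto
        moreover have "real (K q) \<le> real q powr (1 + \<epsilon>)"
          unfolding K_def by (simp add: of_nat_nat)
        ultimately have "real (2 * K q + 1) \<le> 3 * real q powr (1 + \<epsilon>)"
          by simp
        then have "real (2 * K q + 1) * (2 * real q powr (- t)) powr s \<le>
            3 * real q powr (1 + \<epsilon>) * (2 * real q powr (- t)) powr s"
          by (intro mult_right_mono) auto
        also have "\<dots> = 3 * real q powr (1 + \<epsilon>) * (2 powr s * real q powr (- (s * t)))"
          by (simp add: powr_mult powr_powr mult.commute)
        also have "\<dots> = g q"
          using q by (simp add: g_def powr_diff powr_minus divide_inverse)
        finally show "real (2 * K q + 1) * (2 * real q powr (- t)) powr s \<le> g q" .
      qed
      finally show "(\<Sum>j. diameter_power s (B (n, j))) \<le> ennreal (g (n + Q))"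
        by (simp add: q_def)
    qed
    also have "\<dots> = ennreal (\<Sum>n. g (n + Q))"
      using g0 g by (intro suminf_ennreal2) (auto simp: summable_iff_shift)
    also have "\<dots> \<le> ennreal e"
    proof (rule ennreal_leI)
      have "Q2 \<le> Q" by (simp add: Q_def)
      then show "(\<Sum>n. g (n + Q)) \<le> e"
        using Q2[of Q] by simp
    qed
    finally show ?thesis .
  qed
  then show ?thesis
    by (metis ennreal_0 ennreal_le_epsilon add_0 le_zero_eq)
qed

lemma hausdorff_measure_approximable:
  assumes "t > 0" "s * t > 2" "s > 0"
  shows "hausdorff_measure s (approximable t) = 0"
  using hausdorff_premeasure_approximable[OF assms] by (simp add: hausdorff_measure_def)

lemma hausdorff_measure_mono:
  assumes "A \<subseteq> B"
  shows "hausdorff_measure s A \<le> hausdorff_measure s B"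
  unfolding hausdorff_measure_def hausdorff_premeasure_def
  using assms by (intro SUP_mono' INF_superset_mono) auto

lemma hausdorff_dim_le_of_subset_approximable:
  assumes "A \<subseteq> approximable t" and t: "t > 0"
  shows "hausdorff_dim A \<le> ereal (2 / t)"
proof (rule ereal_le_epsilon2)
  fix e :: real assume e: "e > 0"
  have "hausdorff_measure (2 / t + e) (approximable t) = 0"
    using t e by (intro hausdorff_measure_approximable) (auto simp: field_simps add_pos_pos)
  then have "hausdorff_measure (2 / t + e) A = 0"
    using hausdorff_measure_mono[OF assms(1), of "2 / t + e"] by simp
  then have "hausdorff_dim A \<le> ereal (2 / t + e)"
    unfolding hausdorff_dim_def using t e by (intro Inf_lower) (auto intro!: exI[of _ "2 / t + e"])
  then show "hausdorff_dim A \<le> ereal (2 / t) + ereal e" by simp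
qed

lemma hausdorff_dim_nonneg: "0 \<le> hausdorff_dim A"
  unfolding hausdorff_dim_def by (rule Inf_greatest) auto

lemma null_sets_if_hausdorff_measure_1_eq_0:
  fixes A :: "real set"
  assumes "hausdorff_measure 1 A = 0"
  shows "A \<in> null_sets lebesgue"
proof -
  have "\<exists>T. A \<subseteq> T \<and> T \<in> lmeasurable \<and> measure lebesgue T \<le> e" if e: "e > 0" for e
  proof -
    have "hausdorff_premeasure 1 1 A \<le> hausdorff_measure 1 A"
      unfolding hausdorff_measure_def by (rule SUP_upper) simp
    then have "hausdorff_premeasure 1 1 A < ennreal (e / 2)"
      using assms e by simp
    then obtain U :: "nat \<Rightarrow> real set" where U: "A \<subseteq> (\<Union>i. U i)" "\<And>i. bounded (U i)"
      and less: "(\<Sum>i. diameter_power 1 (U i)) < ennreal (e / 2)"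
      unfolding hausdorff_premeasure_def INF_less_iff by auto
    define V where "V = (\<lambda>i. if U i = {} then {} else cball (SOME u. u \<in> U i) (diameter (U i)))"
    have "U i \<subseteq> V i" for i
    proof
      fix u assume u: "u \<in> U i"
      then have "(SOME u. u \<in> U i) \<in> U i" by (rule someI)
      then have "dist (SOME u. u \<in> U i) u \<le> diameter (U i)"
        using u U(2) by (intro diameter_bounded_bound)
      then show "u \<in> V i" using u by (auto simp: V_def)
    qed
    then have "(\<Union>i. U i) \<subseteq> (\<Union>i. V i)"
      by (intro UN_mono subset_refl)
    with U(1) have sub: "A \<subseteq> (\<Union>i. V i)"
      by (rule order_trans)
    have [measurable]: "V i \<in> sets lebesgue" for i by (simp add: V_def)
    have "emeasure lebesgue (\<Union>i. V i) \<le> (\<Sum>i. emeasure lebesgue (V i))"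
      by (rule emeasure_subadditive_countably) auto
    also have "\<dots> = (\<Sum>i. 2 * diameter_power 1 (U i))"
    proof (rule arg_cong[where f = suminf], rule ext)
      fix i
      have "0 \<le> diameter (U i)" by (rule diameter_ge_0[OF U(2)])
      then show "emeasure lebesgue (V i) = 2 * diameter_power 1 (U i)"
        by (simp add: V_def diameter_power_def cball_eq_atLeastAtMost ennreal_mult)
    qed
    also have "\<dots> = 2 * (\<Sum>i. diameter_power 1 (U i))"
      by simp
    also have "\<dots> \<le> 2 * ennreal (e / 2)"
      using less by (intro mult_left_mono) auto
    also have "\<dots> = ennreal e"
      using e by (simp add: ennreal_mult[symmetric] flip: ennreal_numeral)
    finally have le: "emeasure lebesgue (\<Union>i. V i) \<le> ennreal e" .
    then have "(\<Union>i. V i) \<in> lmeasurable"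
      by (intro fmeasurableI) (auto simp: less_top[symmetric] top_unique)
    moreover have "measure lebesgue (\<Union>i. V i) \<le> e"
      using le e by (simp add: measure_def enn2real_leI)
    ultimately show ?thesis using sub by blast
  qed
  then show ?thesis
    by (simp add: negligible_outer_le flip: negligible_iff_null_sets)
qed

lemma eventually_linear_ge:
  fixes c K :: real
  assumes "c > 0"
  shows "\<forall>\<^sub>F m in sequentially. K \<le> c * real m"
  using eventually_ge_at_top[of "nat \<lceil>K / c\<rceil>"]
proof eventually_elim
  case (elim m)
  then have "K / c \<le> real m" by linarith
  then show ?case using assms by (simp add: field_simps)
qed

lemma eventually_overlap:
  fixes l l' t :: real
  assumes "t > 0" "l > 1" "l' > 1" and t: "t * (1 / l' + 1 / (l - 1)) < 1"
  shows "\<forall>\<^sub>F m in sequentially. 1 + t * ((l' * real m + 5) / (l - 1) + real m) \<le> l' * real m"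
proof -
  define c where "c = l' * (1 - t * (1 / l' + 1 / (l - 1)))"
  have "c > 0" using assms by (simp add: c_def)
  then have "\<forall>\<^sub>F m in sequentially. 1 + 5 * t / (l - 1) \<le> c * real m"
    by (rule eventually_linear_ge)
  then show ?thesis
  proof eventually_elim
    case (elim m)
    have "c * real m = l' * real m - t * ((l' * real m) / (l - 1) + real m)"
      using assms by (simp add: c_def field_simps)
    then show ?case
      using elim by (simp add: add_divide_distrib algebra_simps)
  qed
qed

lemma eventually_overlap_complementary:
  fixes l t :: real
  assumes "l > 1" and t: "t * (1 / l + 1 / (l - 1)) < 1"
  shows "\<forall>\<^sub>F m in sequentially. 1 + t * (l * real m + 4) \<le> (l - t) * ((l - 1) * real m - 1)"
proof -
  define c where "c = l * (l - 1) * (1 - t * (1 / l + 1 / (l - 1)))"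
  have "c > 0" using assms by (simp add: c_def)
  then have "\<forall>\<^sub>F m in sequentially. 1 + 4 * t + (l - t) \<le> c * real m"
    by (rule eventually_linear_ge)
  moreover have "c = (l - t) * (l - 1) - t * l"
    using assms by (simp add: c_def field_simps)
  ultimately show ?thesis
    by (simp add: algebra_simps)
qed

lemma odd_dyadic_interval_step:
  fixes \<xi> l l' u :: real and m m' :: nat
  assumes m': "l * real m + 3 \<le> real m'" and l': "l' \<ge> 1"
  shows "\<exists>a :: int. odd a \<and>
    (\<forall>y. of_int a / 2 ^ m' \<le> y \<longrightarrow> y \<le> of_int a / 2 ^ m' + 2 powr (- l' * real m') \<longrightarrow>
      \<xi> - y \<in> {u + 2 powr (- l * real m) / 2 .. u + 2 powr (- l * real m)})"
proof -
  define w where "w = 2 powr (- l * real m)"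
  obtain a :: int where a: "odd a" "\<xi> - u - w \<le> of_int a / 2 ^ m'"
    "of_int a / 2 ^ m' \<le> \<xi> - u - w + 2 / 2 ^ m'"
    using bounded_odd_fraction by blast
  have inv: "1 / 2 ^ m' = 2 powr (- real m')"
    by (simp add: powr_minus powr_realpow divide_inverse)
  have "1 * real m' \<le> l' * real m'"
    using l' by (intro mult_right_mono) auto
  then have 1: "2 powr (- l' * real m') \<le> 1 / 2 ^ m'"
    unfolding inv by simp
  have "1 / 2 ^ m' \<le> 2 powr (- l * real m - 3)"
    unfolding inv using m' by simp
  also have "\<dots> = w / 8"
    by (simp add: w_def powr_diff)
  finally have 2: "3 * (1 / 2 ^ m') \<le> w / 2"
    using powr_ge_zero[of 2 "- l * real m"] unfolding w_def[symmetric] by linarith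
  have "\<xi> - y \<in> {u + w / 2 .. u + w}"
    if "of_int a / 2 ^ m' \<le> y" "y \<le> of_int a / 2 ^ m' + 2 powr (- l' * real m')" for y
  proof -
    have "2 / 2 ^ m' = 2 * (1 / 2 ^ m' :: real)" by simp
    then have "y \<le> \<xi> - u - w + w / 2" using that(2) a(3) 1 2 by linarith
    then show ?thesis using that(1) a(2) by simp
  qed
  then show ?thesis
    using a(1) unfolding w_def by blast
qed

lemma mem_sumset_if_not_approximable:
  fixes \<xi> t l\<^sub>0 l\<^sub>1 :: real
  assumes \<xi>: "\<xi> \<notin> approximable t" and t: "t > 0" and l: "l\<^sub>0 > 1" "l\<^sub>1 > 1"
    and less: "\<And>l l'. l \<in> {l\<^sub>0, l\<^sub>1} \<Longrightarrow> l' \<in> {l\<^sub>0, l\<^sub>1} \<Longrightarrow> t * (1 / l' + 1 / (l - 1)) < 1"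
  shows "\<xi> \<in> \<W> (ereal l\<^sub>0) + \<W> (ereal l\<^sub>1)"
proof -
  define l :: "nat \<Rightarrow> real" where "l = (\<lambda>n. if even n then l\<^sub>0 else l\<^sub>1)"
  have l1: "l n > 1" for n using l by (simp add: l_def)
  have l_less: "t * (1 / l n + 1 / (l k - 1)) < 1" for n k
    using less by (simp add: l_def)
  have lt: "l n > t" for n
  proof -
    have "t / (l n - 1) > 0" using t l1[of n] by simp
    then have "t / l n < 1" using l_less[of n n] by (simp add: distrib_left)
    then show ?thesis using l1[of n] by (simp add: field_simps)
  qed
  obtain Q where Q: "\<And>(p :: int) q. q \<ge> Q \<Longrightarrow> q \<ge> 1 \<Longrightarrow> real q powr (- t) < \<bar>\<xi> - p / real q\<bar>"
    using \<xi> unfolding approximable_def not_le[symmetric] by blast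
  have "\<forall>\<^sub>F m in sequentially. \<forall>i\<in>{0,1}.
      1 + t * (l i * real m + 4) \<le> (l i - t) * ((l i - 1) * real m - 1) \<and>
      1 + t * ((l (Suc i) * real m + 5) / (l i - 1) + real m) \<le> l (Suc i) * real m"
    using t l1 l_less by (intro eventually_ball_finite ballI eventually_conj
        eventually_overlap eventually_overlap_complementary) auto
  then obtain N where N: "\<And>m. m \<ge> N \<Longrightarrow> \<forall>i\<in>{0,1}.
      1 + t * (l i * real m + 4) \<le> (l i - t) * ((l i - 1) * real m - 1) \<and>
      1 + t * ((l (Suc i) * real m + 5) / (l i - 1) + real m) \<le> l (Suc i) * real m"
    unfolding eventually_sequentially by blast

  define m where "m = rec_nat (max N Q) (\<lambda>n k. nat \<lceil>l n * real k\<rceil> + 3)"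
  have m0: "m 0 = max N Q" and mSuc: "m (Suc n) = nat \<lceil>l n * real (m n)\<rceil> + 3" for n
    by (simp_all add: m_def)
  have m_bounds: "l n * real (m n) + 3 \<le> m (Suc n)" "m (Suc n) \<le> l n * real (m n) + 4" for n
  proof -
    have "0 \<le> l n * real (m n)" using l1[of n] by simp
    then show "l n * real (m n) + 3 \<le> m (Suc n)" "m (Suc n) \<le> l n * real (m n) + 4"
      unfolding mSuc by linarith+
  qed
  have "strict_mono m"
  proof (rule strict_monoI_Suc)
    fix n
    have "1 * real (m n) \<le> l n * real (m n)"
      using l1[of n] by (intro mult_right_mono) auto
    then show "m n < m (Suc n)" using m_bounds(1)[of n] by linarith
  qed
  have m_ge: "m n \<ge> N" "m n \<ge> Q" for n
    using strict_mono_less_eq[OF \<open>strict_mono m\<close>, of 0 n] m0 by auto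

  define I where "I = (\<lambda>n (a :: int). {a / 2 ^ m n + 2 powr (- l n * m n) / 2 .. a / 2 ^ m n + 2 powr (- l n * m n)})"
  have "\<exists>a. \<forall>n. odd (a n) \<and> (\<forall>y\<in>I (Suc n) (a (Suc n)). \<xi> - y \<in> I n (a n))"
  proof (rule dependent_nat_choice)
    show "\<exists>a :: int. odd a" by (rule exI[of _ 1]) simp
  next
    fix a :: int and n
    obtain a' :: int where "odd a'" and a': "\<And>y. a' / 2 ^ m (Suc n) \<le> y \<Longrightarrow>
        y \<le> a' / 2 ^ m (Suc n) + 2 powr (- l (Suc n) * m (Suc n)) \<Longrightarrow> \<xi> - y \<in> I n a"
      using odd_dyadic_interval_step[OF m_bounds(1)[of n] less_imp_le[OF l1[of "Suc n"]], of \<xi> "a / 2 ^ m n"]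
      unfolding I_def by blast
    have "\<xi> - y \<in> I n a" if "y \<in> I (Suc n) a'" for y
    proof -
      have "0 \<le> 2 powr (- l (Suc n) * m (Suc n))" by simp
      then show ?thesis using that by (intro a') (auto simp: I_def)
    qed
    then show "\<exists>a'. odd a' \<and> (\<forall>y\<in>I (Suc n) a'. \<xi> - y \<in> I n a)"
      using \<open>odd a'\<close> by blast
  qed
  then obtain a where odd: "\<And>n. odd (a n)"
    and step: "\<And>n y. y \<in> I (Suc n) (a (Suc n)) \<Longrightarrow> \<xi> - y \<in> I n (a n)"
    by blast

  define z where "z = (\<lambda>(n :: nat) x. if even n then x else \<xi> - x)"
  have z_Suc: "z (Suc n) y = z n (\<xi> - y)" "z n (z n y) = y" for n y
    by (simp_all add: z_def)
  have "(\<Inter>n. z n ` I n (a n)) \<noteq> {}"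
  proof (rule compact_nest)
    show "compact (z n ` I n (a n))" for n
      by (rule compact_continuous_image) (cases "even n"; auto simp: z_def I_def intro!: continuous_intros)+
    show "z n ` I n (a n) \<noteq> {}" for n
      by (simp add: I_def)
    have "z (Suc n) ` I (Suc n) (a (Suc n)) \<subseteq> z n ` I n (a n)" for n
      unfolding z_Suc(1) using step by blast
    then show "z n' ` I n' (a n') \<subseteq> z n ` I n (a n)" if "n \<le> n'" for n n'
      using that by (rule lift_Suc_antimono_le)
  qed
  then obtain x where "\<And>n. x \<in> z n ` I n (a n)" by blast
  then have zx: "z n x \<in> I n (a n)" for n
    by (metis imageE z_Suc(2))
  have lower: "2 powr (- l n * m n) / 2 \<le> \<bar>z n x - a n / 2 ^ m n\<bar>"
    and upper: "\<bar>z n x - a n / 2 ^ m n\<bar> \<le> 2 powr (- l n * m n)" for n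
  proof -
    have "0 \<le> 2 powr (- l n * m n)" by simp
    then show "2 powr (- l n * m n) / 2 \<le> \<bar>z n x - a n / 2 ^ m n\<bar>"
      "\<bar>z n x - a n / 2 ^ m n\<bar> \<le> 2 powr (- l n * m n)"
      using zx[of n] unfolding I_def atLeastAtMost_iff by linarith+
  qed
  have "irrationality_exponent (z i x) = ereal (l i)" if i: "i \<in> {0, 1}" for i
  proof (rule exponent_eqI_two_sided[where t = t and \<xi> = \<xi> and l' = "l (Suc i)"
        and a = "\<lambda>k. a (2 * k + i)" and m = "\<lambda>k. m (2 * k + i)"
        and c = "\<lambda>k. a (Suc (2 * k + i))" and d = "\<lambda>k. m (Suc (2 * k + i))"])
    have li: "l (2 * k + i) = l i" "l (Suc (2 * k + i)) = l (Suc i)" for k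
      by (simp_all add: l_def)
    have zi: "z (2 * k + i) x = z i x" "z (Suc (2 * k + i)) x = \<xi> - z i x" for k
      by (simp_all add: z_def)
    fix k
    show "2 powr (- l i * m (2 * k + i)) / 2 \<le> \<bar>z i x - a (2 * k + i) / 2 ^ m (2 * k + i)\<bar>"
      using lower[of "2 * k + i"] by (simp only: li zi)
    show "\<bar>z i x - a (2 * k + i) / 2 ^ m (2 * k + i)\<bar> \<le> 2 powr (- l i * m (2 * k + i))"
      using upper[of "2 * k + i"] by (simp only: li zi)
    show "\<bar>\<xi> - z i x - a (Suc (2 * k + i)) / 2 ^ m (Suc (2 * k + i))\<bar> \<le>
        2 powr (- l (Suc i) * m (Suc (2 * k + i)))"
      using upper[of "Suc (2 * k + i)"] by (simp only: li zi)
    show "m (Suc (2 * k + i)) \<le> l i * m (2 * k + i) + 4"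
      using m_bounds(2)[of "2 * k + i"] by (simp only: li)
    show "m (2 * Suc k + i) \<le> l (Suc i) * m (Suc (2 * k + i)) + 4"
      using m_bounds(2)[of "Suc (2 * k + i)"] by (simp only: li) simp
    show "1 + t * (l i * m (2 * k + i) + 4) \<le> (l i - t) * ((l i - 1) * m (2 * k + i) - 1)"
      using N[OF m_ge(1)] i by blast
    show "1 + t * ((l (Suc i) * m (Suc (2 * k + i)) + 5) / (l i - 1) + m (Suc (2 * k + i)))
        \<le> l (Suc i) * m (Suc (2 * k + i))"
      using N[OF m_ge(1)] i by blast
    show "real (q * 2 ^ m (Suc (2 * k + i))) powr (- t) \<le> \<bar>\<xi> - p / real (q * 2 ^ m (Suc (2 * k + i)))\<bar>"
      if "q \<ge> 1" for p :: int and q :: nat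
    proof (rule less_imp_le, rule Q)
      have "Q \<le> m (Suc (2 * k + i))" by (rule m_ge)
      also have "\<dots> \<le> 1 * 2 ^ m (Suc (2 * k + i))" by (simp add: less_imp_le)
      also have "\<dots> \<le> q * 2 ^ m (Suc (2 * k + i))" using that by (intro mult_right_mono) auto
      finally show "Q \<le> q * 2 ^ m (Suc (2 * k + i))" .
    qed (use that in simp)
  next
    show "strict_mono (\<lambda>k. m (2 * k + i))"
      using \<open>strict_mono m\<close> by (auto simp: strict_mono_def)
  qed (use odd l1 lt t in auto)
  from this[of 0] this[of 1] have "x \<in> \<W> (ereal l\<^sub>0)" "\<xi> - x \<in> \<W> (ereal l\<^sub>1)"
    by (simp_all add: exact_exponent_set_def z_def l_def)
  then have "x + (\<xi> - x) \<in> \<W> (ereal l\<^sub>0) + \<W> (ereal l\<^sub>1)"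
    by (rule set_plus_intro)
  then show ?thesis by simp
qed

theorem theorem3p9:
  "(\<forall>l\<^sub>0 l\<^sub>1 :: real. min l\<^sub>0 l\<^sub>1 > (5 + sqrt 17) / 2 \<longrightarrow>
      \<W> 2 \<subseteq> \<W> (ereal l\<^sub>0) + \<W> (ereal l\<^sub>1) \<and>
      {\<xi>. \<xi> \<notin> \<rat> \<and> \<not> very_well_approximable \<xi>} \<subseteq> \<W> (ereal l\<^sub>0) + \<W> (ereal l\<^sub>1) \<and>
      - (\<W> (ereal l\<^sub>0) + \<W> (ereal l\<^sub>1)) \<in> null_sets lebesgue \<and>
      (let l = min l\<^sub>0 l\<^sub>1 in
         hausdorff_dim (- (\<W> (ereal l\<^sub>0) + \<W> (ereal l\<^sub>1)))
           \<le> ereal (2 * (2 * l - 1) / (l\<^sup>2 - l)) \<and>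
         2 * (2 * l - 1) / (l\<^sup>2 - l) < 1)) \<and>
   ((\<lambda>(l\<^sub>0, l\<^sub>1). hausdorff_dim (- (\<W> (ereal l\<^sub>0) + \<W> (ereal l\<^sub>1)))) \<longlongrightarrow> 0)
     (filtercomap (\<lambda>(l\<^sub>0 :: real, l\<^sub>1 :: real). min l\<^sub>0 l\<^sub>1) at_top)"
proof -
  define dimbound :: "real \<Rightarrow> real" where "dimbound = (\<lambda>l. 2 * (2 * l - 1) / (l\<^sup>2 - l))"
  have main: "\<W> 2 \<subseteq> \<W> (ereal l\<^sub>0) + \<W> (ereal l\<^sub>1)"
    "{\<xi>. \<xi> \<notin> \<rat> \<and> \<not> very_well_approximable \<xi>} \<subseteq> \<W> (ereal l\<^sub>0) + \<W> (ereal l\<^sub>1)"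
    "- (\<W> (ereal l\<^sub>0) + \<W> (ereal l\<^sub>1)) \<in> null_sets lebesgue"
    "hausdorff_dim (- (\<W> (ereal l\<^sub>0) + \<W> (ereal l\<^sub>1))) \<le> ereal (dimbound (min l\<^sub>0 l\<^sub>1))"
    "dimbound (min l\<^sub>0 l\<^sub>1) < 1"
    if large: "min l\<^sub>0 l\<^sub>1 > (5 + sqrt 17) / 2" for l\<^sub>0 l\<^sub>1 :: real
  proof -
    define l where "l = min l\<^sub>0 l\<^sub>1"
    have "l > (5 + sqrt 17) / 2" using large by (simp add: l_def)
    then have "2 * l - 5 > sqrt 17" by (simp add: field_simps)
    then have "(2 * l - 5)\<^sup>2 > (sqrt 17)\<^sup>2" "2 * l - 5 > 0"
      by (intro power_strict_mono, simp_all, smt (verit) real_sqrt_gt_0_iff)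
    then have quad: "l\<^sup>2 - l > 2 * (2 * l - 1)" and l: "l > 2"
      by (simp_all add: power2_eq_square algebra_simps)
    define \<tau> where "\<tau> = (l\<^sup>2 - l) / (2 * l - 1)"
    have \<tau>: "\<tau> > 2" using quad l by (simp add: \<tau>_def field_simps)
    have dim_\<tau>: "dimbound l = 2 / \<tau>" by (simp add: dimbound_def \<tau>_def)
    have "l\<^sup>2 - l = l * (l - 1)" by (simp add: power2_eq_square algebra_simps)
    then have \<tau>_inv: "1 / l + 1 / (l - 1) = 1 / \<tau>"
      using l by (simp add: \<tau>_def field_simps)
    have sub: "- (\<W> (ereal l\<^sub>0) + \<W> (ereal l\<^sub>1)) \<subseteq> approximable t" if t: "0 < t" "t < \<tau>" for t
    proof -
      have "t * (1 / l' + 1 / (l'' - 1)) < 1" if "l' \<ge> l" "l'' \<ge> l" for l' l''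
      proof -
        have "1 / l' + 1 / (l'' - 1) \<le> 1 / l + 1 / (l - 1)"
          using that l by (intro add_mono divide_left_mono) auto
        then have "t * (1 / l' + 1 / (l'' - 1)) \<le> t * (1 / \<tau>)"
          unfolding \<tau>_inv using t by (intro mult_left_mono) auto
        also have "\<dots> < 1" using t by simp
        finally show ?thesis .
      qed
      then have "t * (1 / l' + 1 / (l'' - 1)) < 1" if "l'' \<in> {l\<^sub>0, l\<^sub>1}" "l' \<in> {l\<^sub>0, l\<^sub>1}" for l' l''
        using that by (auto simp: l_def)
      moreover have "l\<^sub>0 > 1" "l\<^sub>1 > 1" using l by (auto simp: l_def)
      ultimately show ?thesis
        using mem_sumset_if_not_approximable[of _ t l\<^sub>0 l\<^sub>1] t(1) by blast
    qed
    define t where "t = (2 + \<tau>) / 2"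
    have t: "t > 2" "t < \<tau>" using \<tau> by (simp_all add: t_def)
    have mem: "\<xi> \<in> \<W> (ereal l\<^sub>0) + \<W> (ereal l\<^sub>1)"
      if "\<xi> \<notin> \<rat>" "irrationality_exponent \<xi> \<le> 2" for \<xi>
    proof -
      have "(2 :: ereal) < ereal t"
        using t(1) by simp
      with that(2) have "irrationality_exponent \<xi> < ereal t"
        by (rule order_le_less_trans)
      then have "\<xi> \<notin> approximable t"
        using not_approximable_if_exponent_less[OF that(1)] t by simp
      then show ?thesis using sub[of t] t by auto
    qed
    then show "{\<xi>. \<xi> \<notin> \<rat> \<and> \<not> very_well_approximable \<xi>} \<subseteq> \<W> (ereal l\<^sub>0) + \<W> (ereal l\<^sub>1)"
      unfolding very_well_approximable_def not_less by blast
    show "\<W> 2 \<subseteq> \<W> (ereal l\<^sub>0) + \<W> (ereal l\<^sub>1)"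
    proof
      fix \<xi> assume "\<xi> \<in> \<W> 2"
      then have "irrationality_exponent \<xi> = 2" by (simp only: exact_exponent_set_def mem_Collect_eq)
      moreover from this have "\<xi> \<notin> \<rat>"
        using irrationality_exponent_Rats_le[of \<xi>] by auto
      ultimately show "\<xi> \<in> \<W> (ereal l\<^sub>0) + \<W> (ereal l\<^sub>1)"
        by (intro mem) auto
    qed
    have "hausdorff_measure 1 (approximable t) = 0"
      using t by (intro hausdorff_measure_approximable) auto
    then have "hausdorff_measure 1 (- (\<W> (ereal l\<^sub>0) + \<W> (ereal l\<^sub>1))) = 0"
      using hausdorff_measure_mono[OF sub[of t], of 1] t by simp
    then show "- (\<W> (ereal l\<^sub>0) + \<W> (ereal l\<^sub>1)) \<in> null_sets lebesgue"
      by (rule null_sets_if_hausdorff_measure_1_eq_0)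
    have "hausdorff_dim (- (\<W> (ereal l\<^sub>0) + \<W> (ereal l\<^sub>1))) \<le> ereal (2 / \<tau>)"
    proof (rule tendsto_lowerbound)
      show "((\<lambda>t. ereal (2 / t)) \<longlongrightarrow> ereal (2 / \<tau>)) (at_left \<tau>)"
        using \<tau> by (intro tendsto_intros) auto
      show "\<forall>\<^sub>F t in at_left \<tau>. hausdorff_dim (- (\<W> (ereal l\<^sub>0) + \<W> (ereal l\<^sub>1))) \<le> ereal (2 / t)"
        unfolding eventually_at_left_field using \<tau>
        hausdorff_dim_le_of_subset_approximable[OF sub]
        by (intro exI[of _ 0]) auto
    qed simp
    then show "hausdorff_dim (- (\<W> (ereal l\<^sub>0) + \<W> (ereal l\<^sub>1))) \<le> ereal (dimbound (min l\<^sub>0 l\<^sub>1))"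
      by (simp add: dim_\<tau> flip: l_def)
    show "dimbound (min l\<^sub>0 l\<^sub>1) < 1"
      using \<tau> by (simp add: dim_\<tau> flip: l_def)
  qed
  have "((\<lambda>(l\<^sub>0, l\<^sub>1). hausdorff_dim (- (\<W> (ereal l\<^sub>0) + \<W> (ereal l\<^sub>1)))) \<longlongrightarrow> 0)
     (filtercomap (\<lambda>(l\<^sub>0 :: real, l\<^sub>1 :: real). min l\<^sub>0 l\<^sub>1) at_top)" (is "(?dim \<longlongrightarrow> 0) ?F")
  proof (rule tendsto_sandwich)
    show "\<forall>\<^sub>F z in ?F. 0 \<le> ?dim z"
      by (simp add: hausdorff_dim_nonneg case_prod_unfold)
    have "\<forall>\<^sub>F l in at_top. l > (5 + sqrt 17) / 2"
      by (rule eventually_gt_at_top)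
    then have "\<forall>\<^sub>F z in ?F. (case z of (l\<^sub>0, l\<^sub>1) \<Rightarrow> min l\<^sub>0 l\<^sub>1) > (5 + sqrt 17) / 2"
      by (rule eventually_filtercomapI)
    then show "\<forall>\<^sub>F z in ?F. ?dim z \<le> ereal (dimbound (case z of (l\<^sub>0, l\<^sub>1) \<Rightarrow> min l\<^sub>0 l\<^sub>1))"
    proof eventually_elim
      case (elim z)
      then show ?case using main(4) by (cases z) auto
    qed
    have "(dimbound \<longlongrightarrow> 0) at_top"
      unfolding dimbound_def by real_asymp
    then have "((\<lambda>l. ereal (dimbound l)) \<longlongrightarrow> 0) at_top"
      by (simp add: zero_ereal_def)
    then show "((\<lambda>z. ereal (dimbound (case z of (l\<^sub>0, l\<^sub>1) \<Rightarrow> min l\<^sub>0 l\<^sub>1))) \<longlongrightarrow> 0) ?F"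
      by (rule filterlim_filtercomapI)
  qed simp
  then show ?thesis
    using main unfolding dimbound_def Let_def by blast
qed

end
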